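(* Let $k \geq 3$ be an integer and $p \geq k$ a prime. There exist constants $C_{p,k} > 0$ and $c_{p,k} > 0$, a function $\epsilon: \mathbb{R}^+ \to \mathbb{R}^+$ with $\epsilon(x) \to 0$ as $x \to \infty$, and a function $\delta: \mathbb{N} \to [0,1]$ with $\delta(n) \to 0$ as $n \to \infty$, such that the following holds. Let $n$ be a positive integer and $s$ a positive integer with \[ s \leq \binom{n+k-2}{k-1} - C_{p,k}(\log_p n)^{1+\epsilon(n)} n^{k-2}. \] Let $S \subset \mathbb{F}_p^n$ be the set $\{x_1,\dots,x_s\}$, where $x_1, \dots, x_s$ are independent, uniformly distributed random elements of $\mathbb{F}_p^n$. Then with probability at least $1 - \delta(n)$ there is a set $A \subset \mathbb{F}_p^n$ with $|A| \geq c_{p,k}\, p^n$ that contains no proper $k$-term arithmetic progression with common difference in $S$, i.e. there are no $x \in \mathbb{F}_p^n$ and $d \in S\setminus\{0\}$ with $x, x+d, \dots, x+(k-1)d \in A$.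
   Context: $\mathbb{F}_p^n$ is the $n$-dimensional vector space over the field with $p$ elements. A $k$-term arithmetic progression with common difference $d$ is a tuple $(x, x+d, \dots, x+(k-1)d)$; it is proper if $d \neq 0$. The constants $C_{p,k}, c_{p,k}$ and the functions $\epsilon,\delta$ may depend on $p$ and $k$ but not on $n$ or $s$. *)

theory Defs
  imports
    "HOL-Probability.Product_PMF"
    "Berlekamp_Zassenhaus.Finite_Field"
    "Jordan_Normal_Form.Matrix"
begin

text \<open>
  The field with \<open>p\<close> elements is the type \<open>'p mod_ring\<close> with \<open>'p :: prime_card\<close> and
  \<open>p = CARD('p)\<close>; its \<open>n\<close>-dimensional vector space is \<open>carrier_vec n :: 'p mod_ring vec set\<close>.
\<close>

definition arith_prog :: "nat \<Rightarrow> 'a::semiring_1 vec \<Rightarrow> 'a vec \<Rightarrow> 'a vec list" where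
  "arith_prog k x d = map (\<lambda>i. x + of_nat i \<cdot>\<^sub>v d) [0..<k]"

definition proper_ap_free ::
  "nat \<Rightarrow> nat \<Rightarrow> 'a::semiring_1 vec set \<Rightarrow> 'a vec set \<Rightarrow> bool" where
  "proper_ap_free n k S A \<longleftrightarrow>
     \<not> (\<exists>x \<in> carrier_vec n. \<exists>d \<in> S - {0\<^sub>v n}. set (arith_prog k x d) \<subseteq> A)"

text \<open>
  The joint law of \<open>x\<^sub>1, \<dots>, x\<^sub>s\<close>, independent and uniform on the \<open>n\<close>-dimensional space.
  The value \<open>undefined\<close> is taken only at indices outside \<open>{1..s}\<close>.
\<close>

definition random_vecs :: "nat \<Rightarrow> nat \<Rightarrow> (nat \<Rightarrow> 'p::prime_card mod_ring vec) pmf" where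
  "random_vecs n s = Pi_pmf {1..s} undefined (\<lambda>_. pmf_of_set (carrier_vec n))"

text \<open>\<open>pmf_of_set\<close> is uniform only on finite nonempty sets, so this is needed to read
  \<open>random_vecs\<close> as intended.\<close>

lemma carrier_vec_mod_ring:
  "finite (carrier_vec n :: 'p::prime_card mod_ring vec set)"
  "carrier_vec n \<noteq> ({} :: 'p mod_ring vec set)"
  "card (carrier_vec n :: 'p mod_ring vec set) = CARD('p) ^ n"
proof -
  let ?L = "{xs :: 'p mod_ring list. set xs \<subseteq> UNIV \<and> length xs = n}"
  have eq: "(carrier_vec n :: 'p mod_ring vec set) = vec_of_list ` ?L"
  proof (intro equalityI subsetI)
    fix v :: "'p mod_ring vec" assume "v \<in> carrier_vec n"
    then have "list_of_vec v \<in> ?L" by simp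
    then show "v \<in> vec_of_list ` ?L" by (rule image_eqI[where f = vec_of_list, OF vec_list[of v, symmetric]])
  next
    fix v :: "'p mod_ring vec" assume "v \<in> vec_of_list ` ?L"
    then obtain xs where "v = vec_of_list xs" "length xs = n" by blast
    then have "dim_vec v = n" by simp
    then show "v \<in> carrier_vec n" by (rule carrier_vecI)
  qed
  have inj: "inj_on vec_of_list ?L" by (rule inj_on_inverseI[of _ list_of_vec]) (simp add: list_vec)
  have fin: "finite ?L" by (rule finite_lists_length_eq) simp
  show "finite (carrier_vec n :: 'p mod_ring vec set)" unfolding eq by (rule finite_imageI[OF fin])
  show "carrier_vec n \<noteq> ({} :: 'p mod_ring vec set)" using zero_carrier_vec[of n] by (metis empty_iff)
  have "card ?L = card (UNIV :: 'p mod_ring set) ^ n" by (rule card_lists_length_eq) simp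
  then show "card (carrier_vec n :: 'p mod_ring vec set) = CARD('p) ^ n"
    unfolding eq card_image[OF inj] CARD_mod_ring .
qed

end

theory Submission
  imports Defs
begin

text \<open>
  Let \<open>d = k - 1\<close>. If \<open>P\<close> is a combination of squarefree monomials of degree \<open>d\<close> with \<open>P h \<noteq> 0\<close> for
  all \<open>h \<in> S\<close>, then a progression with difference \<open>h \<in> S\<close> cannot lie in a level set of \<open>P\<close>: along
  the line \<open>x + t h\<close> the polynomial \<open>P\<close> has degree exactly \<open>d\<close>, so it takes no value \<open>d + 1\<close> times.
  The largest level set has density at least \<open>1 / p\<close>.

  Such a \<open>P\<close> is built one point at a time, which succeeds unless some \<open>x\<^sub>i\<close> lies in the common
  zero set \<open>Z\<close> of all \<open>P\<close> vanishing at \<open>x\<^sub>1, \<dots>, x\<^sub>i\<^sub>-\<^sub>1\<close>. These \<open>P\<close> have at least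
  \<open>(n choose d) - (i - 1)\<close> leading monomials, of which at least
  \<open>((n choose d) - (i - 1)) / (d n\<^sup>d\<^sup>-\<^sup>1)\<close> can be chosen with pairwise disjoint supports. By the
  footprint bound the density of \<open>Z\<close> is then at most \<open>(1 - ((p - 1) / p)\<^sup>d)\<close> to the power of their
  number, which is \<open>O(n\<^sup>-\<^sup>d\<^sup>-\<^sup>1)\<close> as soon as \<open>C\<close> is large; a union bound over \<open>i\<close> finishes the
  proof. Restricting to squarefree monomials costs only \<open>O(n\<^sup>d\<^sup>-\<^sup>1)\<close> dimensions.
\<close>

unbundle no vec_syntax

section \<open>Dimension inequalities by counting over a finite field\<close>

text \<open>Independence makes evaluation on \<open>X\<close> injective on coefficient vectors; over
  a field with \<open>q\<close> elements this yields \<open>q ^ card M \<le> q ^ card X\<close>.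
  Counting thus takes the place of dimensions.\<close>

lemma card_le_if_independent:
  fixes g :: "'m \<Rightarrow> 'b \<Rightarrow> 'a::{finite,field}"
  assumes "finite M" "finite X"
    and indep: "\<And>c. (\<forall>x\<in>X. (\<Sum>m\<in>M. c m * g m x) = 0) \<Longrightarrow> \<forall>m\<in>M. c m = 0"
  shows "card M \<le> card X"
proof -
  let ?F = "\<lambda>c. restrict (\<lambda>x. \<Sum>m\<in>M. c m * g m x) X"
  have inj: "inj_on ?F (M \<rightarrow>\<^sub>E UNIV)"
  proof (rule inj_onI)
    fix c c' assume cc: "c \<in> M \<rightarrow>\<^sub>E UNIV" "c' \<in> M \<rightarrow>\<^sub>E UNIV" and eq: "?F c = ?F c'"
    have "\<forall>x\<in>X. (\<Sum>m\<in>M. (c m - c' m) * g m x) = 0"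
      using eq by (auto simp: left_diff_distrib sum_subtractf fun_eq_iff restrict_def split: if_splits)
    then have "\<forall>m\<in>M. c m - c' m = 0" by (rule indep)
    then show "c = c'" by (intro PiE_ext[OF cc]) simp
  qed
  have "card (M \<rightarrow>\<^sub>E (UNIV :: 'a set)) \<le> card (X \<rightarrow>\<^sub>E (UNIV :: 'a set))"
    using assms(1,2) by (intro card_inj_on_le[OF inj] finite_PiE) auto
  then have "CARD('a) ^ card M \<le> CARD('a) ^ card X"
    using assms(1,2) by (simp add: card_PiE)
  moreover have "1 < CARD('a)"
    using card_mono[of "UNIV :: 'a set" "{0,1}"] by simp
  ultimately show ?thesis by (rule power_le_imp_le_exp[rotated])
qed

text \<open>The dual count: evaluation now maps the coefficient vectors onto the functions on
  \<open>X\<close>.\<close>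

lemma card_le_if_spanning:
  fixes g :: "'m \<Rightarrow> 'b \<Rightarrow> 'a::{finite,field}"
  assumes "finite M" "finite X"
    and span: "\<And>f. \<exists>c. \<forall>x\<in>X. f x = (\<Sum>m\<in>M. c m * g m x)"
  shows "card X \<le> card M"
proof -
  let ?F = "\<lambda>c. restrict (\<lambda>x. \<Sum>m\<in>M. c m * g m x) X"
  have sub: "(X \<rightarrow>\<^sub>E UNIV) \<subseteq> ?F ` (M \<rightarrow>\<^sub>E UNIV)"
  proof
    fix f :: "'b \<Rightarrow> 'a" assume f: "f \<in> X \<rightarrow>\<^sub>E UNIV"
    obtain c where c: "\<forall>x\<in>X. f x = (\<Sum>m\<in>M. c m * g m x)" using span by blast
    have "f = ?F (restrict c M)"
    proof
      fix x show "f x = ?F (restrict c M) x"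
        using c PiE_arb[OF f, of x] by (cases "x \<in> X") simp_all
    qed
    then show "f \<in> ?F ` (M \<rightarrow>\<^sub>E UNIV)" by (rule image_eqI[where f = ?F]) auto
  qed
  have "card (X \<rightarrow>\<^sub>E (UNIV :: 'a set)) \<le> card (M \<rightarrow>\<^sub>E (UNIV :: 'a set))"
    using assms(1,2) by (intro surj_card_le[OF _ sub] finite_PiE) auto
  then have "CARD('a) ^ card X \<le> CARD('a) ^ card M"
    using assms(1,2) by (simp add: card_PiE)
  moreover have "1 < CARD('a)"
    using card_mono[of "UNIV :: 'a set" "{0,1}"] by simp
  ultimately show ?thesis by (rule power_le_imp_le_exp[rotated])
qed

section \<open>Squarefree polynomials, leading monomials and closures\<close>

text \<open>A monomial is its set of variables and a polynomial its coefficient function, so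
  homogeneity of degree \<open>d\<close> is a matter of choosing \<open>M\<close>.\<close>

definition sqf_poly :: "nat set set \<Rightarrow> (nat set \<Rightarrow> 'a::comm_ring_1) \<Rightarrow> 'a vec \<Rightarrow> 'a" where
  "sqf_poly M c x = (\<Sum>T\<in>M. c T * (\<Prod>i\<in>T. x $ i))"

text \<open>The order on squarefree monomials compares \<open>set_encode T = (\<Sum>i\<in>T. 2 ^ i)\<close>; on all monomials it
  extends to the additive weight \<open>\<Sum>i. a i * 2 ^ i\<close> of the exponent vector.\<close>

definition leading :: "nat set set \<Rightarrow> 'a::comm_ring_1 vec set \<Rightarrow> nat set set" where
  "leading M X = {T \<in> M. \<exists>c. c T = 1 \<and> (\<forall>T'\<in>M. set_encode T < set_encode T' \<longrightarrow> c T' = 0) \<and>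
     (\<forall>x\<in>X. sqf_poly M c x = 0)}"

text \<open>The zero set \<open>Z\<close> of the overview. Over a field and for finite
  \<open>M\<close>, these are the points whose evaluation functional lies in the span of the
  evaluations at \<open>X\<close>.\<close>

definition closure_pts :: "nat \<Rightarrow> nat set set \<Rightarrow> 'a::comm_ring_1 vec set \<Rightarrow> 'a vec set" where
  "closure_pts n M X = {y \<in> carrier_vec n.
     \<forall>c. (\<forall>x\<in>X. sqf_poly M c x = 0) \<longrightarrow> sqf_poly M c y = 0}"

lemma sqf_poly_add: "sqf_poly M (\<lambda>T. b T + c T) x = sqf_poly M b x + sqf_poly M c x"
  by (simp add: sqf_poly_def sum.distrib distrib_right)

text \<open>The monomials outside \<open>leading M X\<close> are independent as functions on
  \<open>X\<close>: a relation between them, divided by the coefficient of its largest monomial,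
  would exhibit that monomial as leading. So there are at most \<open>card X\<close> of
  them.\<close>

lemma card_leading:
  fixes X :: "'a::{finite,field} vec set"
  assumes M: "finite M" "\<And>T. T \<in> M \<Longrightarrow> finite T" and X: "finite X"
  shows "card M \<le> card (leading M X) + card X"
proof -
  let ?L = "leading M X"
  have LM: "?L \<subseteq> M" by (auto simp: leading_def)
  have "card (M - ?L) \<le> card X"
  proof (rule card_le_if_independent[where g = "\<lambda>T x. \<Prod>i\<in>T. x $ i"])
    show "finite (M - ?L)" "finite X" using assms by auto
    fix c :: "nat set \<Rightarrow> 'a"
    assume c: "\<forall>x\<in>X. (\<Sum>T\<in>M - ?L. c T * (\<Prod>i\<in>T. x $ i)) = 0"
    show "\<forall>T\<in>M - ?L. c T = 0"
    proof (rule ccontr)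
      assume "\<not> ?thesis"
      then have ne: "{T \<in> M - ?L. c T \<noteq> 0} \<noteq> {}" by blast
      have fin: "finite {T \<in> M - ?L. c T \<noteq> 0}" using M by simp
      obtain T where T: "T \<in> {T \<in> M - ?L. c T \<noteq> 0}"
        and mx: "\<And>T'. T' \<in> {T \<in> M - ?L. c T \<noteq> 0} \<Longrightarrow> set_encode T' \<le> set_encode T"
      proof -
        let ?E = "set_encode ` {T \<in> M - ?L. c T \<noteq> 0}"
        have "Max ?E \<in> ?E" using ne fin by (intro Max_in) auto
        then obtain T where "T \<in> {T \<in> M - ?L. c T \<noteq> 0}" "set_encode T = Max ?E" by (metis (no_types, lifting) imageE)
        then show thesis using fin by (intro that[of T]) auto
      qed
      define b where "b T' = (if T' \<in> M - ?L then inverse (c T) * c T' else 0)" for T'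
      have "sqf_poly M b x = 0" if "x \<in> X" for x
      proof -
        have "sqf_poly M b x = (\<Sum>T'\<in>M - ?L. inverse (c T) * (c T' * (\<Prod>i\<in>T'. x $ i)))"
          unfolding sqf_poly_def using M by (intro sum.mono_neutral_cong_right) (auto simp: b_def)
        also have "\<dots> = 0" using c that by (simp flip: sum_distrib_left)
        finally show ?thesis .
      qed
      moreover have "b T = 1" using T by (simp add: b_def)
      moreover have "\<forall>T'\<in>M. set_encode T < set_encode T' \<longrightarrow> b T' = 0"
        using mx by (auto simp: b_def simp flip: not_le)
      ultimately have "T \<in> ?L" using T unfolding leading_def by blast
      then show False using T by blast
    qed
  qed
  moreover have "card M = card ?L + card (M - ?L)"
    using M LM by (metis card_Diff_subset card_mono finite_subset le_add_diff_inverse)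
  ultimately show ?thesis by simp
qed

section \<open>The footprint bound\<close>

definition mono_eval :: "nat \<Rightarrow> (nat \<Rightarrow> nat) \<Rightarrow> 'a::comm_ring_1 vec \<Rightarrow> 'a" where
  "mono_eval n a x = (\<Prod>i<n. x $ i ^ a i)"

text \<open>Exponent vectors of the footprint: reduced by \<open>x ^ q = x\<close> and divisible by
  no monomial of \<open>\<T>\<close>. Fixing the values outside \<open>I\<close> makes the set
  finite for finite \<open>I\<close>, so that it can be counted.\<close>

definition standard_exps :: "nat \<Rightarrow> nat set \<Rightarrow> nat set set \<Rightarrow> (nat \<Rightarrow> nat) set" where
  "standard_exps q I \<T> = {a \<in> I \<rightarrow>\<^sub>E {..<q}. \<forall>T\<in>\<T>. \<exists>i\<in>T. a i = 0}"

text \<open>Agreement is required only on \<open>Z\<close>, so an identity valid on \<open>Z\<close>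
  can serve as a rewriting rule.\<close>

definition spanned :: "'m set \<Rightarrow> ('m \<Rightarrow> 'b \<Rightarrow> 'a::comm_ring_1) \<Rightarrow> 'b set \<Rightarrow> ('b \<Rightarrow> 'a) set" where
  "spanned G g Z = {f. \<exists>c. \<forall>z\<in>Z. f z = (\<Sum>m\<in>G. c m * g m z)}"

lemma spanned_cong: "f \<in> spanned G g Z \<Longrightarrow> (\<And>z. z \<in> Z \<Longrightarrow> f z = f' z) \<Longrightarrow> f' \<in> spanned G g Z"
  unfolding spanned_def by auto

lemma spanned_base: "finite G \<Longrightarrow> m \<in> G \<Longrightarrow> g m \<in> spanned G g Z"
  unfolding spanned_def
  by (intro CollectI exI[of _ "\<lambda>m'. if m' = m then 1 else 0"]) (simp add: if_distrib[of "\<lambda>x. x * _"] sum.delta cong: if_cong)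

lemma spanned_scale: assumes "f \<in> spanned G g Z" shows "(\<lambda>z. b * f z) \<in> spanned G g Z"
proof -
  obtain c where "\<forall>z\<in>Z. f z = (\<Sum>m\<in>G. c m * g m z)" using assms by (auto simp: spanned_def)
  then show ?thesis unfolding spanned_def
    by (intro CollectI exI[of _ "\<lambda>m. b * c m"]) (simp add: sum_distrib_left mult.assoc)
qed

lemma spanned_add:
  assumes "f \<in> spanned G g Z" "f' \<in> spanned G g Z"
  shows "(\<lambda>z. f z + f' z) \<in> spanned G g Z"
proof -
  obtain c c' where "\<forall>z\<in>Z. f z = (\<Sum>m\<in>G. c m * g m z)" "\<forall>z\<in>Z. f' z = (\<Sum>m\<in>G. c' m * g m z)"
    using assms by (auto simp: spanned_def)
  then show ?thesis unfolding spanned_def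
    by (intro CollectI exI[of _ "\<lambda>m. c m + c' m"]) (simp add: sum.distrib distrib_right)
qed

lemma spanned_0: "(\<lambda>z. 0) \<in> spanned G g Z"
  unfolding spanned_def by (intro CollectI exI[of _ "\<lambda>m. 0"]) simp

lemma spanned_sum:
  assumes "\<And>j. j \<in> J \<Longrightarrow> F j \<in> spanned G g Z"
  shows "(\<lambda>z. \<Sum>j\<in>J. F j z) \<in> spanned G g Z"
  using assms by (induction J rule: infinite_finite_induct) (auto intro: spanned_0 spanned_add)

lemma spanned_trans:
  assumes "f \<in> spanned H h Z" "\<And>m. m \<in> H \<Longrightarrow> h m \<in> spanned G g Z"
  shows "f \<in> spanned G g Z"
proof -
  obtain c where c: "\<forall>z\<in>Z. f z = (\<Sum>m\<in>H. c m * h m z)" using assms by (auto simp: spanned_def)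
  have "(\<lambda>z. \<Sum>m\<in>H. c m * h m z) \<in> spanned G g Z"
    by (intro spanned_sum spanned_scale assms)
  then show ?thesis by (rule spanned_cong) (use c in simp)
qed

lemma finite_standard_exps: "finite I \<Longrightarrow> finite (standard_exps q I \<T>)"
  unfolding standard_exps_def by (rule finite_subset[of _ "I \<rightarrow>\<^sub>E {..<q}"]) (auto intro: finite_PiE)

text \<open>Division algorithm on \<open>Z\<close>: an exponent of at least
  \<open>q = CARD('a)\<close> is lowered by \<open>x ^ q = x\<close>, and a factor from
  \<open>\<T>\<close> is replaced through the polynomial that has it as leading monomial and
  vanishes on \<open>Z\<close>. Both lower the weight on which the induction runs; since the weight
  is additive, the order survives multiplication by a cofactor.\<close>

lemma mono_eval_spanned:
  fixes Z :: "'a::finite_field vec set"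
  assumes M: "finite M" "\<And>T. T \<in> M \<Longrightarrow> T \<subseteq> {..<n}" and \<T>: "\<T> \<subseteq> leading M X"
    and Z: "Z \<subseteq> closure_pts n M X"
  shows "mono_eval n a \<in> spanned (standard_exps CARD('a) {..<n} \<T>) (mono_eval n) Z"
proof (induction "\<Sum>i<n. a i * 2 ^ i" arbitrary: a rule: less_induct)
  case less
  let ?S = "standard_exps CARD('a) {..<n} \<T>"
  have q2: "2 \<le> CARD('a)"
    using card_mono[of "UNIV :: 'a set" "{0,1}"] by simp
  consider (big) i where "i < n" "CARD('a) \<le> a i"
    | (lead) T where "T \<in> \<T>" "\<forall>i\<in>T. a i \<noteq> 0"
    | (std) "\<forall>i<n. a i < CARD('a)" "\<forall>T\<in>\<T>. \<exists>i\<in>T. a i = 0"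
    by (meson not_le)
  then show ?case
  proof cases
    case big
    \<comment> \<open>The new exponent is still positive, so the value is unchanged also where the
      coordinate is 0; it is strictly smaller because \<open>CARD('a) \<ge> 2\<close>.\<close>
    define b where "b = a(i := Suc (a i - CARD('a)))"
    have "(\<Sum>j<n. b j * 2 ^ j) < (\<Sum>j<n. a j * 2 ^ j)"
      using big q2 by (intro sum_strict_mono_ex1) (auto simp: b_def)
    then have "mono_eval n b \<in> spanned ?S (mono_eval n) Z" by (rule less)
    moreover have "x ^ Suc (a i - CARD('a)) = x ^ a i" for x :: 'a
    proof -
      have "x ^ a i = x ^ (a i - CARD('a)) * x ^ CARD('a)" using big by (simp flip: power_add)
      then show ?thesis by (simp add: finite_field_power_card_eq_same)
    qed
    then have "mono_eval n b z = mono_eval n a z" for z :: "'a vec"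
      unfolding mono_eval_def by (intro prod.cong) (auto simp: b_def)
    ultimately show ?thesis by (rule spanned_cong)
  next
    case lead
    then have "T \<in> leading M X" using \<T> by blast
    then obtain c where T: "T \<in> M" and c: "c T = 1"
      "\<And>T'. T' \<in> M \<Longrightarrow> set_encode T < set_encode T' \<Longrightarrow> c T' = 0"
      "\<forall>x\<in>X. sqf_poly M c x = 0"
      unfolding leading_def by blast
    have fin: "finite T'" if "T' \<in> M" for T' using M(2)[OF that] finite_subset by blast
    \<comment> \<open>\<open>a'\<close> is the cofactor of the monomial \<open>T\<close> in
      \<open>a\<close>, and \<open>b T'\<close> is that cofactor times \<open>T'\<close>. The
      truncated subtraction is exact because \<open>a\<close> is nonzero on \<open>T\<close>; hence
      \<open>a = b T\<close>.\<close>
    define a' where "a' i = a i - (if i \<in> T then 1 else 0)" for i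
    define b where "b T' i = a' i + (if i \<in> T' then 1 else 0)" for T' i
    have split: "mono_eval n (b T') z = mono_eval n a' z * (\<Prod>i\<in>T'. z $ i)" if "T' \<in> M" for T' and z :: "'a vec"
    proof -
      have "(\<Prod>i\<in>T'. z $ i) = (\<Prod>i<n. z $ i ^ (if i \<in> T' then 1 else 0))"
        using M(2)[OF that] by (intro prod.mono_neutral_cong_left) auto
      then show ?thesis by (simp add: mono_eval_def b_def power_add prod.distrib)
    qed
    have wt: "(\<Sum>i<n. b T' i * 2 ^ i) = (\<Sum>i<n. a' i * 2 ^ i) + set_encode T'" if "T' \<in> M" for T'
    proof -
      have "set_encode T' = (\<Sum>i<n. (if i \<in> T' then 1 else 0) * 2 ^ i)"
        unfolding set_encode_def using M(2)[OF that] by (intro sum.mono_neutral_cong_left) auto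
      then show ?thesis by (simp only: b_def distrib_right sum.distrib)
    qed
    have ab: "a = b T" using lead by (auto simp: b_def a'_def fun_eq_iff)
    have sp: "mono_eval n (b T') \<in> spanned ?S (mono_eval n) Z"
      if "T' \<in> M - {T}" "c T' \<noteq> 0" for T'
    proof (rule less)
      \<comment> \<open>Monomials above \<open>T\<close> have coefficient 0 and
        \<open>set_encode\<close> is injective on finite sets, so the remaining ones lie strictly
        below \<open>T\<close>.\<close>
      have "set_encode T' \<noteq> set_encode T" using that fin T by (subst set_encode_eq) auto
      moreover have "\<not> set_encode T < set_encode T'" using c(2) that by blast
      ultimately show "(\<Sum>i<n. b T' i * 2 ^ i) < (\<Sum>i<n. a i * 2 ^ i)"
        using wt that T by (simp add: ab)
    qed
    have "(\<lambda>z. \<Sum>T'\<in>M - {T}. - c T' * mono_eval n (b T') z) \<in> spanned ?S (mono_eval n) Z"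
    proof (rule spanned_sum)
      fix T' assume "T' \<in> M - {T}"
      then show "(\<lambda>z. - c T' * mono_eval n (b T') z) \<in> spanned ?S (mono_eval n) Z"
        using sp[of T'] by (cases "c T' = 0") (simp_all only: minus_zero mult_zero_left spanned_0 spanned_scale not_False_eq_True)
    qed
    then show ?thesis
    proof (rule spanned_cong)
      fix z assume "z \<in> Z"
      then have "sqf_poly M c z = 0" using Z c(3) by (auto simp: closure_pts_def)
      then have eq: "(\<Prod>i\<in>T. z $ i) = (\<Sum>T'\<in>M - {T}. - c T' * (\<Prod>i\<in>T'. z $ i))"
        using M T by (simp add: sqf_poly_def sum.remove[of M T] c(1) sum_negf add_eq_0_iff)
      show "(\<Sum>T'\<in>M - {T}. - c T' * mono_eval n (b T') z) = mono_eval n a z"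
        unfolding ab split[OF T] eq sum_distrib_left by (intro sum.cong) (auto simp: split)
    qed
  next
    case std
    have TM: "T \<subseteq> {..<n}" if "T \<in> \<T>" for T using that \<T> M(2) unfolding leading_def by blast
    have "restrict a {..<n} \<in> ?S"
      unfolding standard_exps_def
    proof (intro CollectI conjI ballI)
      show "restrict a {..<n} \<in> {..<n} \<rightarrow>\<^sub>E {..<CARD('a)}" using std by auto
      fix T assume "T \<in> \<T>"
      with std obtain i where "i \<in> T" "a i = 0" by blast
      then show "\<exists>i\<in>T. restrict a {..<n} i = 0" using TM[OF \<open>T \<in> \<T>\<close>] by (intro bexI[of _ i]) auto
    qed
    then have "mono_eval n (restrict a {..<n}) \<in> spanned ?S (mono_eval n) Z"
      by (intro spanned_base finite_standard_exps finite_lessThan)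
    then show ?thesis by (rule spanned_cong) (simp add: mono_eval_def)
  qed
qed

text \<open>Indicator functions of points are, up to scaling, products of linear factors
  \<open>z $ i - u\<close>, so they stay within the span of all monomials.\<close>

lemma card_closure_le_standard:
  fixes X :: "'a::finite_field vec set"
  assumes M: "finite M" "\<And>T. T \<in> M \<Longrightarrow> T \<subseteq> {..<n}" and \<T>: "\<T> \<subseteq> leading M X"
    and fin: "finite (carrier_vec n :: 'a vec set)"
  shows "card (closure_pts n M X) \<le> card (standard_exps CARD('a) {..<n} \<T>)"
proof -
  let ?S = "standard_exps CARD('a) {..<n} \<T>" and ?Z = "closure_pts n M X"
  let ?U = "spanned ?S (mono_eval n) ?Z"
  have Zc: "?Z \<subseteq> carrier_vec n" by (auto simp: closure_pts_def)
  have mono: "mono_eval n a \<in> ?U" for a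
    by (rule mono_eval_spanned[OF M \<T> order_refl])
  \<comment> \<open>Multiplication by a coordinate preserves \<open>?U\<close>: it raises one
    exponent of each standard monomial, and every monomial, standard or not, lies in
    \<open>?U\<close>.\<close>
  have var: "(\<lambda>z. z $ i * f z) \<in> ?U" if i: "i < n" and f: "f \<in> ?U" for i f
  proof -
    obtain c where c: "\<forall>z\<in>?Z. f z = (\<Sum>m\<in>?S. c m * mono_eval n m z)"
      using f unfolding spanned_def by blast
    have "(\<lambda>z. z $ i * f z) \<in> spanned ?S (\<lambda>a z. z $ i * mono_eval n a z) ?Z"
      unfolding spanned_def using c
      by (intro CollectI exI[of _ c]) (simp add: sum_distrib_left mult.left_commute)
    moreover have "(\<lambda>z. z $ i * mono_eval n a z) \<in> ?U" for a
    proof (rule spanned_cong[OF mono[of "a(i := Suc (a i))"]])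
      fix z :: "'a vec"
      show "mono_eval n (a(i := Suc (a i))) z = z $ i * mono_eval n a z"
        using i unfolding mono_eval_def
        by (simp add: prod.remove[of "{..<n}" i])
    qed
    ultimately show ?thesis by (rule spanned_trans)
  qed
  have lin: "(\<lambda>z. (z $ i - u) * f z) \<in> ?U" if "i < n" "f \<in> ?U" for i u f
  proof -
    have "(\<lambda>z. z $ i * f z + (- u) * f z) \<in> ?U"
      by (intro spanned_add var spanned_scale that)
    then show ?thesis by (rule spanned_cong) (simp add: algebra_simps)
  qed
  have prods: "(\<lambda>z. \<Prod>w\<in>W. z $ fst w - snd w) \<in> ?U" if "finite W" "W \<subseteq> {..<n} \<times> UNIV" for W
    using that
  proof (induction W rule: finite_induct)
    case empty
    show ?case by (rule spanned_cong[OF mono[of "\<lambda>_. 0"]]) (simp add: mono_eval_def)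
  next
    case (insert w W)
    have "(\<lambda>z. (z $ fst w - snd w) * (\<Prod>w\<in>W. z $ fst w - snd w)) \<in> ?U"
      using insert.prems by (intro lin insert.IH) auto
    then show ?case by (rule spanned_cong) (simp add: insert.hyps)
  qed
  have delta: "(\<lambda>z. if z = y then 1 else 0) \<in> ?U" if y: "y \<in> ?Z" for y
  proof -
    let ?W = "{(i, u). i < n \<and> u \<noteq> y $ i}"
    define h where "h z = (\<Prod>w\<in>?W. z $ fst w - snd w)" for z
    have finW: "finite ?W" by (rule finite_subset[of _ "{..<n} \<times> UNIV"]) auto
    have "h \<in> ?U" unfolding h_def using finW by (intro prods) auto
    then have "(\<lambda>z. inverse (h y) * h z) \<in> ?U" by (rule spanned_scale)
    then show ?thesis
    proof (rule spanned_cong)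
      fix z assume z: "z \<in> ?Z"
      have "h y \<noteq> 0" unfolding h_def prod_zero_iff[OF finW] by auto
      moreover have "h z = 0" if "z \<noteq> y"
      proof -
        have "dim_vec z = n" "dim_vec y = n" using y z by (simp_all add: closure_pts_def)
        then have "\<exists>i<n. z $ i \<noteq> y $ i" using that eq_vecI[of y z] by metis
        then obtain i where "i < n" "z $ i \<noteq> y $ i" by blast
        then show ?thesis unfolding h_def by (intro prod_zero[OF finW] bexI[of _ "(i, z $ i)"]) auto
      qed
      ultimately show "inverse (h y) * h z = (if z = y then 1 else 0)" by auto
    qed
  qed
  have finZ: "finite ?Z" using fin Zc finite_subset by blast
  show ?thesis
  proof (rule card_le_if_spanning[OF _ finZ])
    show "finite ?S" by (rule finite_standard_exps) simp
    fix f :: "'a vec \<Rightarrow> 'a"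
    \<comment> \<open>Every function on \<open>?Z\<close> is a combination of indicators, so the
      standard monomials span all functions on \<open>?Z\<close>.\<close>
    have "(\<lambda>z. \<Sum>y\<in>?Z. f y * (if z = y then 1 else 0)) \<in> ?U"
      by (intro spanned_sum spanned_scale delta)
    then have "f \<in> ?U"
      by (rule spanned_cong) (simp add: finZ if_distrib sum.delta cong: if_cong)
    then show "\<exists>c. \<forall>x\<in>?Z. f x = (\<Sum>m\<in>?S. c m * mono_eval n m x)" by (simp add: spanned_def)
  qed
qed

section \<open>Counting with pairwise disjoint leading monomials\<close>

text \<open>Disjoint members of \<open>\<T>\<close> constrain separate coordinates. Each excludes
  the \<open>(q - 1) ^ d\<close> choices that are nonzero throughout it, leaving the fraction
  \<open>1 - ((q - 1) / q) ^ d\<close>. The induction splits \<open>I\<close> into \<open>T\<close>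
  and \<open>I - T\<close>.\<close>

lemma card_standard_exps:
  assumes "finite \<T>" "finite I" "disjoint \<T>" "\<And>T. T \<in> \<T> \<Longrightarrow> T \<subseteq> I \<and> card T = d" "0 < q"
  shows "real (card (standard_exps q I \<T>)) \<le> real q ^ card I * (1 - ((real q - 1) / real q) ^ d) ^ card \<T>"
  using assms
proof (induction \<T> arbitrary: I rule: finite_induct)
  case empty
  then show ?case by (simp add: standard_exps_def card_PiE)
next
  case (insert T \<T>)
  let ?\<rho> = "1 - ((real q - 1) / real q) ^ d"
  have T: "T \<subseteq> I" "card T = d" using insert.prems(3)[of T] by simp_all
  then have "finite T" using insert.prems(1) finite_subset by blast
  have disj: "T' \<inter> T = {}" if "T' \<in> \<T>" for T'
    using insert.prems(2) insert.hyps that by (auto simp: disjoint_def)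
  let ?F = "\<lambda>a. (restrict a T, restrict a (I - T))"
  have img: "?F ` standard_exps q I (insert T \<T>) \<subseteq> standard_exps q T {T} \<times> standard_exps q (I - T) \<T>"
  proof
    fix y assume "y \<in> ?F ` standard_exps q I (insert T \<T>)"
    then obtain a where a: "y = ?F a" "a \<in> I \<rightarrow>\<^sub>E {..<q}" "\<And>T'. T' \<in> insert T \<T> \<Longrightarrow> \<exists>i\<in>T'. a i = 0"
      by (auto simp: standard_exps_def)
    have "restrict a (I - T) \<in> standard_exps q (I - T) \<T>"
      unfolding standard_exps_def
    proof (intro CollectI conjI ballI)
      show "restrict a (I - T) \<in> (I - T) \<rightarrow>\<^sub>E {..<q}" using a(2) by auto
      fix T' assume T': "T' \<in> \<T>"
      then obtain i where "i \<in> T'" "a i = 0" using a(3) by blast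
      moreover have "T' \<subseteq> I" using insert.prems(3) T' by blast
      ultimately show "\<exists>i\<in>T'. restrict a (I - T) i = 0"
        using disj[OF T'] by (intro bexI[of _ i]) auto
    qed
    moreover have "restrict a T \<in> standard_exps q T {T}"
      using a(2) a(3)[of T] T(1) by (auto simp: standard_exps_def)
    ultimately show "y \<in> standard_exps q T {T} \<times> standard_exps q (I - T) \<T>"
      using a(1) by blast
  qed
  have inj: "inj_on ?F (standard_exps q I (insert T \<T>))"
  proof (rule inj_onI)
    fix a b assume ab: "a \<in> standard_exps q I (insert T \<T>)" "b \<in> standard_exps q I (insert T \<T>)" "?F a = ?F b"
    have "a \<in> I \<rightarrow>\<^sub>E {..<q}" "b \<in> I \<rightarrow>\<^sub>E {..<q}" using ab by (auto simp: standard_exps_def)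
    then show "a = b"
    proof (rule PiE_ext)
      fix i assume "i \<in> I"
      moreover have "restrict a T i = restrict b T i" "restrict a (I - T) i = restrict b (I - T) i"
        using ab(3) by simp_all
      ultimately show "a i = b i" by (cases "i \<in> T") simp_all
    qed
  qed
  have "card (standard_exps q I (insert T \<T>)) \<le> card (standard_exps q T {T} \<times> standard_exps q (I - T) \<T>)"
    using insert.prems(1) \<open>finite T\<close> by (intro card_inj_on_le[OF inj img] finite_cartesian_product finite_standard_exps) auto
  then have 1: "real (card (standard_exps q I (insert T \<T>)))
      \<le> real (card (standard_exps q T {T})) * real (card (standard_exps q (I - T) \<T>))"
    by (simp add: card_cartesian_product flip: of_nat_mult)
  have "standard_exps q T {T} = (T \<rightarrow>\<^sub>E {..<q}) - (T \<rightarrow>\<^sub>E {1..<q})"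
    by (simp add: set_eq_iff standard_exps_def PiE_iff Suc_le_eq) (metis bot_nat_0.not_eq_extremum)
  moreover have "card ((T \<rightarrow>\<^sub>E {..<q}) - (T \<rightarrow>\<^sub>E {1..<q}))
      = card (T \<rightarrow>\<^sub>E {..<q}) - card (T \<rightarrow>\<^sub>E {1..<q})"
    using \<open>finite T\<close> by (intro card_Diff_subset finite_PiE PiE_mono) auto
  ultimately have "card (standard_exps q T {T}) = q ^ d - (q - 1) ^ d"
    using T \<open>finite T\<close> by (simp add: card_PiE)
  then have "real (card (standard_exps q T {T})) = real q ^ d - (real q - 1) ^ d"
    using insert.prems(4) by (simp add: of_nat_diff power_mono)
  also have "\<dots> = real q ^ d * ?\<rho>"
    using insert.prems(4) by (simp add: power_divide right_diff_distrib)
  finally have 2: "real (card (standard_exps q T {T})) = real q ^ d * ?\<rho>" .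
  have \<rho>: "0 \<le> ?\<rho>" using insert.prems(4) by (simp add: power_le_one)
  have "real (card (standard_exps q (I - T) \<T>)) \<le> real q ^ card (I - T) * ?\<rho> ^ card \<T>"
  proof (rule insert.IH)
    show "finite (I - T)" "disjoint \<T>" "0 < q"
      using insert.prems by (auto simp: disjoint_def)
    show "T' \<subseteq> I - T \<and> card T' = d" if "T' \<in> \<T>" for T'
      using insert.prems(3)[of T'] disj[OF that] that by auto
  qed
  then have "real q ^ d * ?\<rho> * real (card (standard_exps q (I - T) \<T>))
      \<le> real q ^ d * ?\<rho> * (real q ^ card (I - T) * ?\<rho> ^ card \<T>)"
    using \<rho> by (intro mult_left_mono mult_nonneg_nonneg) simp_all
  with 1 have "real (card (standard_exps q I (insert T \<T>)))
      \<le> real q ^ d * ?\<rho> * (real q ^ card (I - T) * ?\<rho> ^ card \<T>)"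
    unfolding 2 by (rule order_trans)
  moreover have "card I = d + card (I - T)"
    using T \<open>finite T\<close> insert.prems(1) by (metis card_Diff_subset card_mono le_add_diff_inverse)
  ultimately show ?case using insert.hyps by (simp add: power_add mult_ac)
qed

text \<open>A maximal disjoint subfamily works: every member of \<open>L\<close> meets its union,
  which has at most \<open>card \<T> * d\<close> points, and each point lies in at most
  \<open>n ^ (d - 1)\<close> sets of size \<open>d\<close>.\<close>

lemma ex_disjoint_subfamily:
  fixes L :: "nat set set"
  assumes L: "\<And>T. T \<in> L \<Longrightarrow> T \<subseteq> {..<n} \<and> card T = d" and "0 < d"
  shows "\<exists>\<T>\<subseteq>L. disjoint \<T> \<and> card L \<le> card \<T> * (d * n ^ (d - 1))"
proof -
  have finL: "finite L" by (rule finite_subset[of _ "Pow {..<n}"]) (use L in auto)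
  let ?D = "{\<T>. \<T> \<subseteq> L \<and> disjoint \<T>}"
  have finD: "finite ?D" by (rule finite_subset[of _ "Pow L"]) (use finL in auto)
  have "{} \<in> ?D" by (simp add: disjoint_def)
  then have "?D \<noteq> {}" by (metis empty_iff)
  with finD have "\<exists>\<T>\<in>?D. \<forall>\<U>\<in>?D. \<T> \<subseteq> \<U> \<longrightarrow> \<T> = \<U>" by (rule finite_has_maximal)
  then obtain \<T> where \<T>: "\<T> \<subseteq> L" "disjoint \<T>" and mx: "\<forall>\<U>\<in>?D. \<T> \<subseteq> \<U> \<longrightarrow> \<T> = \<U>"
    by auto
  have fin\<T>: "finite \<T>" using \<T> finL finite_subset by blast
  have dT: "card T = d" "finite T" "T \<noteq> {}" if "T \<in> L" for T
    using L[OF that] \<open>0 < d\<close> finite_subset[of T "{..<n}"] by auto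
  have finU: "finite (\<Union>\<T>)"
    by (rule finite_Union[OF fin\<T>]) (use \<T>(1) dT(2) in blast)
  have cU: "card (\<Union>\<T>) \<le> card \<T> * d"
  proof -
    have "card (\<Union>\<T>) \<le> sum card \<T>" by (rule card_Union_le_sum_card)
    also have "\<dots> = card \<T> * d" using \<T> dT by (simp add: subset_iff)
    finally show ?thesis .
  qed
  define G where "G u = {T. T \<subseteq> {..<n} \<and> card T = d \<and> u \<in> T}" for u
  have finG: "finite (G u)" for u
    unfolding G_def by (rule finite_subset[of _ "Pow {..<n}"]) auto
  have cG: "card (G u) \<le> n ^ (d - 1)" for u
  proof -
    have "card (G u) \<le> card {T. T \<subseteq> {..<n} \<and> card T = d - 1}"
    proof (rule card_inj_on_le[where f = "\<lambda>T. T - {u}"])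
      show "inj_on (\<lambda>T. T - {u}) (G u)" by (rule inj_onI) (auto simp: G_def)
      show "(\<lambda>T. T - {u}) ` G u \<subseteq> {T. T \<subseteq> {..<n} \<and> card T = d - 1}"
        by (auto simp: G_def)
    qed simp
    also have "\<dots> = n choose (d - 1)" by (simp add: n_subsets)
    also have "\<dots> \<le> n ^ (d - 1)"
      by (cases "d - 1 \<le> n") (auto intro: binomial_le_pow simp: binomial_eq_0)
    finally show ?thesis .
  qed
  \<comment> \<open>A member missing the union could be added, so by maximality it already belongs
    to \<open>\<T>\<close>; being nonempty, as \<open>0 < d\<close>, it then meets the union after
    all.\<close>
  have meet: "T \<inter> \<Union>\<T> \<noteq> {}" if T: "T \<in> L" for T
  proof
    assume e: "T \<inter> \<Union>\<T> = {}"
    then have "insert T \<T> \<in> ?D" using \<T> T by (auto simp: disjoint_def)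
    with mx have "\<T> \<subseteq> insert T \<T> \<longrightarrow> \<T> = insert T \<T>" by (rule bspec)
    then have "T \<in> \<T>" by auto
    then have "T \<subseteq> \<Union>\<T>" by (rule Union_upper)
    then show False using e dT(3)[OF T] by (simp add: Int_absorb2)
  qed
  have "L \<subseteq> (\<Union>u\<in>\<Union>\<T>. G u)"
  proof
    fix T assume T: "T \<in> L"
    then have "\<exists>u. u \<in> T \<inter> \<Union>\<T>" using meet[OF T] by (simp only: ex_in_conv not_False_eq_True)
    then obtain u where u: "u \<in> T" "u \<in> \<Union>\<T>" by (elim exE IntE)
    then have "T \<in> G u" using L[OF T] by (simp add: G_def)
    with u(2) show "T \<in> (\<Union>u\<in>\<Union>\<T>. G u)" by (rule UN_I)
  qed
  then have "card L \<le> card (\<Union>u\<in>\<Union>\<T>. G u)"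
    by (intro card_mono finite_UN_I finU finG)
  also have "\<dots> \<le> (\<Sum>u\<in>\<Union>\<T>. card (G u))"
    by (rule card_UN_le[OF finU])
  also have "\<dots> \<le> card (\<Union>\<T>) * n ^ (d - 1)"
    using sum_bounded_above[of "\<Union>\<T>" "\<lambda>u. card (G u)" "n ^ (d - 1)"] cG by simp
  also have "\<dots> \<le> card \<T> * d * n ^ (d - 1)" using cU by (rule mult_le_mono1)
  finally show ?thesis using \<T> by (auto simp: mult.assoc)
qed

section \<open>Polynomials along lines and progression-free level sets\<close>

text \<open>A squarefree monomial restricted to the line \<open>x + t h\<close> is such a product,
  and its coefficient at \<open>t ^ card T\<close> is the monomial evaluated at
  \<open>h\<close>.\<close>

lemma coeff_prod_linear:
  fixes a b :: "'i \<Rightarrow> 'a::comm_ring_1"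
  assumes "finite T"
  shows "degree (\<Prod>i\<in>T. [:a i, b i:]) \<le> card T \<and> poly.coeff (\<Prod>i\<in>T. [:a i, b i:]) (card T) = (\<Prod>i\<in>T. b i)"
  using assms
proof (induction T rule: finite_induct)
  case (insert i T)
  let ?P = "\<Prod>i\<in>T. [:a i, b i:]"
  have "degree ([:a i, b i:] * ?P) \<le> degree [:a i, b i:] + degree ?P" by (rule degree_mult_le)
  also have "\<dots> \<le> 1 + card T" using insert.IH by (intro add_mono) auto
  finally have "degree ([:a i, b i:] * ?P) \<le> Suc (card T)" by simp
  moreover have "poly.coeff ?P (Suc (card T)) = 0" using insert.IH by (intro coeff_eq_0) auto
  ultimately show ?case using insert by (simp add: mult_pCons_left)
qed simp

text \<open>By homogeneity, the coefficient at \<open>t ^ (k - 1)\<close> of the polynomial along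
  \<open>x + t h\<close> is its value at \<open>h\<close>. This is nonzero, so \<open>v\<close> is
  taken for at most \<open>k - 1\<close> parameters \<open>t\<close>, whereas a progression in the
  level set supplies \<open>k\<close>.\<close>

lemma level_set_proper_ap_free:
  fixes c :: "nat set \<Rightarrow> 'p::prime_card mod_ring"
  assumes k: "2 \<le> k" "k \<le> CARD('p)" and "finite M"
    and M: "\<And>T. T \<in> M \<Longrightarrow> T \<subseteq> {..<n} \<and> card T = k - 1"
    and S: "\<And>h. h \<in> S \<Longrightarrow> sqf_poly M c h \<noteq> 0"
  shows "proper_ap_free n k S {x \<in> carrier_vec n. sqf_poly M c x = v}"
proof -
  have False if x: "x \<in> carrier_vec n" and h: "h \<in> S"
    and ap: "set (arith_prog k x h) \<subseteq> {x \<in> carrier_vec n. sqf_poly M c x = v}" for x h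
  proof -
    have ap: "x + of_nat j \<cdot>\<^sub>v h \<in> carrier_vec n" "sqf_poly M c (x + of_nat j \<cdot>\<^sub>v h) = v" if "j < k" for j
    proof -
      have "x + of_nat j \<cdot>\<^sub>v h \<in> set (arith_prog k x h)" using that by (simp add: arith_prog_def)
      then have "x + of_nat j \<cdot>\<^sub>v h \<in> {x \<in> carrier_vec n. sqf_poly M c x = v}" using ap by blast
      then show "x + of_nat j \<cdot>\<^sub>v h \<in> carrier_vec n" "sqf_poly M c (x + of_nat j \<cdot>\<^sub>v h) = v" by auto
    qed
    \<comment> \<open>The length of \<open>h\<close> comes from the term \<open>j = 0\<close> of the
      progression: a sum of vectors has the length of its second summand.\<close>
    have dim: "dim_vec h = n" "dim_vec x = n" using ap(1)[of 0] k x by (auto dest: carrier_vecD)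
    define Q where "Q = (\<Sum>T\<in>M. Polynomial.smult (c T) (\<Prod>i\<in>T. [:x $ i, h $ i:]))"
    have fin: "finite T" if "T \<in> M" for T using M[OF that] finite_subset by blast
    have "poly Q (of_nat j) = v" if "j < k" for j
    proof -
      have "(x + of_nat j \<cdot>\<^sub>v h) $ i = x $ i + of_nat j * h $ i" if "T \<in> M" "i \<in> T" for T i
        using M[OF that(1)] that dim by auto
      then have "poly Q (of_nat j) = sqf_poly M c (x + of_nat j \<cdot>\<^sub>v h)"
        unfolding Q_def sqf_poly_def
        by (auto simp: poly_sum poly_prod intro!: sum.cong prod.cong)
      then show ?thesis using ap(2)[OF that] by simp
    qed
    then have roots: "of_nat ` {..<k} \<subseteq> {z. poly (Q - [:v:]) z = 0}" by auto
    have deg: "degree (Q - [:v:]) \<le> k - 1"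
    proof (rule degree_diff_le)
      show "degree Q \<le> k - 1"
        unfolding Q_def
      proof (rule degree_sum_le[OF \<open>finite M\<close>])
        fix T assume T: "T \<in> M"
        show "degree (Polynomial.smult (c T) (\<Prod>i\<in>T. [:x $ i, h $ i:])) \<le> k - 1"
          using coeff_prod_linear[OF fin[OF T], of "\<lambda>i. x $ i" "\<lambda>i. h $ i"] M[OF T] degree_smult_le order_trans
          by metis
      qed
    qed simp
    have "poly.coeff Q (k - 1) = sqf_poly M c h"
      unfolding Q_def sqf_poly_def coeff_sum
    proof (rule sum.cong[OF refl])
      fix T assume T: "T \<in> M"
      show "poly.coeff (Polynomial.smult (c T) (\<Prod>i\<in>T. [:x $ i, h $ i:])) (k - 1) = c T * (\<Prod>i\<in>T. h $ i)"
        using coeff_prod_linear[OF fin[OF T], of "\<lambda>i. x $ i" "\<lambda>i. h $ i"] M[OF T] by simp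
    qed
    moreover have "poly.coeff [:v:] (k - 1) = 0" using k by (intro coeff_eq_0) simp
    ultimately have ne: "Q - [:v:] \<noteq> 0" using S[OF h] by (metis coeff_0 coeff_diff diff_zero)
    \<comment> \<open>Here \<open>k \<le> CARD('p)\<close> enters: the parameters
      \<open>0, ..., k - 1\<close> are distinct field elements.\<close>
    have "inj_on (of_nat :: nat \<Rightarrow> 'p mod_ring) {..<k}"
      using k(2) by (auto intro!: inj_onI simp: of_nat_eq_iff_cong_CHAR cong_def)
    then have "k = card ((of_nat :: nat \<Rightarrow> 'p mod_ring) ` {..<k})" by (simp add: card_image)
    also have "\<dots> \<le> card {z. poly (Q - [:v:]) z = 0}"
      by (rule card_mono[OF poly_roots_finite[OF ne] roots])
    also have "\<dots> \<le> k - 1" using card_poly_roots_bound[OF ne] deg by simp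
    finally show False using k by simp
  qed
  then show ?thesis unfolding proper_ap_free_def by blast
qed

lemma ex_large_level_set:
  fixes f :: "'b \<Rightarrow> 'a::finite"
  assumes "finite V"
  shows "\<exists>v. card V \<le> CARD('a) * card {x \<in> V. f x = v}"
proof (rule ccontr)
  assume "\<not> ?thesis"
  then have lt: "CARD('a) * card {x \<in> V. f x = v} < card V" for v by (simp add: not_le)
  have "card V = (\<Sum>v\<in>UNIV. card {x \<in> V. f x = v})"
    by (simp only: card_eq_sum sum.group[OF assms finite subset_UNIV])
  then have "CARD('a) * card V = (\<Sum>v\<in>UNIV. CARD('a) * card {x \<in> V. f x = v})"
    by (simp add: sum_distrib_left)
  also have "\<dots> < (\<Sum>v\<in>(UNIV :: 'a set). card V)"
    by (rule sum_strict_mono) (use lt in auto)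
  finally show False by simp
qed

section \<open>Density of closures and random points\<close>

text \<open>By \<open>card_leading\<close> the hypothesis leaves at least
  \<open>m * (d * n ^ (d - 1))\<close> leading monomials, hence \<open>m\<close> disjoint ones, each
  contributing one factor to the footprint bound.\<close>

lemma card_closure_le:
  fixes X :: "'a::finite_field vec set"
  assumes "0 < d" "0 < n" "finite X" "finite (carrier_vec n :: 'a vec set)"
    and X: "card X + m * (d * n ^ (d - 1)) \<le> n choose d"
  shows "real (card (closure_pts n {T. T \<subseteq> {..<n} \<and> card T = d} X))
     \<le> real CARD('a) ^ n * (1 - ((real CARD('a) - 1) / real CARD('a)) ^ d) ^ m"
proof -
  let ?M = "{T. T \<subseteq> {..<n} \<and> card T = d}"
  let ?\<rho> = "1 - ((real CARD('a) - 1) / real CARD('a)) ^ d"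
  have finM: "finite ?M" by (rule finite_subset[of _ "Pow {..<n}"]) auto
  have finT: "finite T" if "T \<in> ?M" for T using that finite_subset[of T "{..<n}"] by blast
  have LM: "T \<subseteq> {..<n} \<and> card T = d" if "T \<in> leading ?M X" for T
    using that by (simp add: leading_def)
  obtain \<T> where \<T>: "\<T> \<subseteq> leading ?M X" "disjoint \<T>"
    "card (leading ?M X) \<le> card \<T> * (d * n ^ (d - 1))"
    using ex_disjoint_subfamily[of "leading ?M X", OF LM \<open>0 < d\<close>] by blast
  have fin\<T>: "finite \<T>"
    by (rule finite_subset[OF \<T>(1)], rule finite_subset[OF _ finM]) (auto simp: leading_def)
  have "1 \<le> real CARD('a)" by (simp add: Suc_le_eq)
  then have \<rho>: "0 \<le> ?\<rho>" "?\<rho> \<le> 1" by (simp_all add: power_le_one)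
  have "n choose d \<le> card (leading ?M X) + card X"
    using card_leading[OF finM finT \<open>finite X\<close>] n_subsets[of "{..<n}" d] by simp
  then have "m * (d * n ^ (d - 1)) \<le> card \<T> * (d * n ^ (d - 1))"
    using \<T>(3) X by linarith
  then have m: "m \<le> card \<T>" using \<open>0 < d\<close> \<open>0 < n\<close> by simp
  have "card (closure_pts n ?M X) \<le> card (standard_exps CARD('a) {..<n} \<T>)"
    by (rule card_closure_le_standard[OF finM _ \<T>(1) assms(4)]) simp
  then have "real (card (closure_pts n ?M X)) \<le> real (card (standard_exps CARD('a) {..<n} \<T>))"
    by (rule of_nat_mono)
  also have "\<dots> \<le> real CARD('a) ^ card {..<n} * ?\<rho> ^ card \<T>"
  proof (rule card_standard_exps[OF fin\<T> _ \<T>(2)])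
    show "T \<subseteq> {..<n} \<and> card T = d" if "T \<in> \<T>" for T
      using \<T>(1) that by (intro LM) (rule subsetD)
  qed simp_all
  also have "\<dots> \<le> real CARD('a) ^ n * ?\<rho> ^ m"
    using power_decreasing[OF m \<rho>] by (simp only: card_lessThan mult_left_mono of_nat_0_le_iff zero_le_power)
  finally show ?thesis .
qed

text \<open>Some polynomial vanishes at all earlier points but not at the new one. Adding it
  whenever the current polynomial vanishes at the new point repairs that value and leaves the
  earlier ones alone.\<close>

lemma ex_nonvanishing:
  fixes s :: nat
  assumes "\<And>i. i \<in> {1..s} \<Longrightarrow> x i \<in> carrier_vec n"
    and "\<And>i. i \<in> {1..s} \<Longrightarrow> x i \<notin> closure_pts n M (x ` {1..<i})"
  shows "\<exists>c. \<forall>i\<in>{1..s}. sqf_poly M c (x i) \<noteq> 0"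
  using assms
proof (induction s)
  case (Suc s)
  have "\<exists>c. \<forall>i\<in>{1..s}. sqf_poly M c (x i) \<noteq> 0" using Suc.prems by (intro Suc.IH) auto
  then obtain c where c: "sqf_poly M c (x i) \<noteq> 0" if "i \<in> {1..s}" for i by blast
  have "x (Suc s) \<in> carrier_vec n" "x (Suc s) \<notin> closure_pts n M (x ` {1..<Suc s})"
    using Suc.prems[of "Suc s"] by simp_all
  then obtain b where b: "\<And>y. y \<in> x ` {1..<Suc s} \<Longrightarrow> sqf_poly M b y = 0" "sqf_poly M b (x (Suc s)) \<noteq> 0"
    unfolding closure_pts_def by blast
  define a where "a = (if sqf_poly M c (x (Suc s)) = 0 then (\<lambda>T. c T + b T) else c)"
  have "sqf_poly M a (x i) \<noteq> 0" if i: "i \<in> {1..Suc s}" for i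
  proof (cases "i = Suc s")
    case True
    then show ?thesis using b(2) by (simp add: a_def sqf_poly_add)
  next
    case False
    then have "i \<in> {1..s}" using i by simp
    then show ?thesis using c[of i] b(1)[of "x i"] by (simp add: a_def sqf_poly_add)
  qed
  then show ?case by blast
qed simp

text \<open>The target set of \<open>x i\<close> depends only on earlier points. With all other
  coordinates fixed it is a fixed set, which the uniform \<open>x i\<close> hits with probability at
  most \<open>\<beta>\<close>.\<close>

lemma prob_random_vecs_mem:
  fixes B :: "'p::prime_card mod_ring vec set \<Rightarrow> 'p mod_ring vec set"
  assumes i: "i \<in> {1..s}" and \<beta>: "0 \<le> \<beta>"
    and B: "\<And>X. finite X \<Longrightarrow> card X < s \<Longrightarrow> real (card (B X)) \<le> \<beta> * real CARD('p) ^ n"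
    and sub: "\<And>X. B X \<subseteq> carrier_vec n"
  shows "measure_pmf.prob (random_vecs n s) {x. x i \<in> B (x ` {1..<i})} \<le> \<beta>"
proof -
  let ?U = "pmf_of_set (carrier_vec n) :: 'p mod_ring vec pmf"
  let ?E = "{x. x i \<in> B (x ` {1..<i})}"
  let ?P = "Pi_pmf ({1..s} - {i}) undefined (\<lambda>_. ?U)"
  have "random_vecs n s = Pi_pmf (insert i ({1..s} - {i})) undefined (\<lambda>_. ?U)"
    unfolding random_vecs_def using i by (simp add: insert_absorb)
  also have "\<dots> = bind_pmf ?U (\<lambda>y. bind_pmf ?P (\<lambda>f. return_pmf (f(i := y))))"
    by (rule Pi_pmf_insert') auto
  \<comment> \<open>Exchanging the two draws puts coordinate \<open>i\<close> last, so that it is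
    uniform for each fixed choice \<open>f\<close> of the others.\<close>
  also have "\<dots> = bind_pmf ?P (\<lambda>f. map_pmf (\<lambda>y. f(i := y)) ?U)"
    unfolding map_pmf_def by (rule bind_commute_pmf)
  finally have eq: "random_vecs n s = bind_pmf ?P (\<lambda>f. map_pmf (\<lambda>y. f(i := y)) ?U)" .
  have le: "emeasure (measure_pmf (map_pmf (\<lambda>y. f(i := y)) ?U)) ?E \<le> ennreal \<beta>" for f
  proof -
    let ?X = "f ` {1..<i}"
    \<comment> \<open>The range \<open>{1..<i}\<close> excludes \<open>i\<close>, so
      \<open>?X\<close> does not depend on \<open>y\<close>; it has at most \<open>i - 1 < s\<close>
      points.\<close>
    have "(f(i := y)) ` {1..<i} = ?X" for y by (rule image_cong) auto
    then have vi: "(\<lambda>y. f(i := y)) -` ?E = B ?X" by auto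
    have "card ?X \<le> card {1..<i}" by (rule card_image_le) simp
    then have "card ?X < s" using i unfolding card_atLeastLessThan atLeastAtMost_iff by linarith
    then have "real (card (B ?X)) \<le> \<beta> * real CARD('p) ^ n" by (intro B) auto
    moreover have "measure_pmf.prob ?U (B ?X) = real (card (B ?X)) / real (CARD('p) ^ n)"
      using sub[of ?X] by (simp add: measure_pmf_of_set carrier_vec_mod_ring Int_absorb1)
    ultimately have "measure_pmf.prob ?U (B ?X) \<le> \<beta>" by (simp add: divide_le_eq)
    then show ?thesis
      by (simp add: vi measure_pmf.emeasure_eq_measure ennreal_leI)
  qed
  have "emeasure (measure_pmf (random_vecs n s)) ?E
      = (\<integral>\<^sup>+f. emeasure (measure_pmf (map_pmf (\<lambda>y. f(i := y)) ?U)) ?E \<partial>measure_pmf ?P)"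
    unfolding eq by (rule emeasure_bind_pmf)
  also have "\<dots> \<le> (\<integral>\<^sup>+f. ennreal \<beta> \<partial>measure_pmf ?P)"
    by (intro nn_integral_mono le)
  also have "\<dots> = ennreal \<beta>" by simp
  finally show ?thesis using \<beta> by (simp add: measure_pmf.emeasure_eq_measure)
qed

text \<open>Union bound over the events that \<open>x i\<close> falls into the closure of its
  predecessors. Outside them some polynomial is nonzero at all the points, and its largest level set
  is the required \<open>A\<close>.\<close>

lemma prob_ex_ap_free:
  fixes k n s :: nat and \<beta> :: real
  assumes k: "2 \<le> k" "k \<le> CARD('p::prime_card)" and \<beta>: "0 \<le> \<beta>"
    and B: "\<And>X :: 'p mod_ring vec set. finite X \<Longrightarrow> card X < s \<Longrightarrow>
      real (card (closure_pts n {T. T \<subseteq> {..<n} \<and> card T = k - 1} X)) \<le> \<beta> * real CARD('p) ^ n"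
  shows "1 - real s * \<beta> \<le> measure_pmf.prob (random_vecs n s)
        {x :: nat \<Rightarrow> 'p mod_ring vec.
          \<exists>A \<subseteq> carrier_vec n.
            1 / real CARD('p) * real CARD('p) ^ n \<le> real (card A) \<and>
            proper_ap_free n k (x ` {1..s}) A}" (is "_ \<le> measure_pmf.prob ?R ?G")
proof -
  let ?M = "{T. T \<subseteq> {..<n} \<and> card T = k - 1}"
  \<comment> \<open>The zero vector lies in every closure, since the monomials have degree
    \<open>k - 1 \<ge> 1\<close>; a zero difference is therefore counted among the bad
    events.\<close>
  let ?E = "\<lambda>i. {x :: nat \<Rightarrow> 'p mod_ring vec. x i \<in> closure_pts n ?M (x ` {1..<i})}"
  have finM: "finite ?M" by (rule finite_subset[of _ "Pow {..<n}"]) auto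
  have "measure_pmf.prob ?R (\<Union>i\<in>{1..s}. ?E i) \<le> (\<Sum>i\<in>{1..s}. measure_pmf.prob ?R (?E i))"
    by (rule measure_pmf.finite_measure_subadditive_finite) auto
  also have "\<dots> \<le> (\<Sum>i\<in>{1..s}. \<beta>)"
    by (intro sum_mono prob_random_vecs_mem \<beta> B) (auto simp: closure_pts_def)
  finally have bad: "measure_pmf.prob ?R (\<Union>i\<in>{1..s}. ?E i) \<le> real s * \<beta>" by simp
  \<comment> \<open>The inclusion is restricted to the support, where every \<open>x i\<close> with
    \<open>i \<in> {1..s}\<close> lies in \<open>carrier_vec n\<close>; the restriction does not
    change the probability.\<close>
  have sub: "(UNIV - (\<Union>i\<in>{1..s}. ?E i)) \<inter> set_pmf ?R \<subseteq> ?G"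
  proof (rule subsetI)
    fix x assume "x \<in> (UNIV - (\<Union>i\<in>{1..s}. ?E i)) \<inter> set_pmf ?R"
    then have xb: "x \<notin> (\<Union>i\<in>{1..s}. ?E i)" "x \<in> set_pmf ?R"
      by (simp_all only: Int_iff Diff_iff not_False_eq_True)
    have xc: "x i \<in> carrier_vec n" if "i \<in> {1..s}" for i
    proof -
      have "x \<in> PiE_dflt {1..s} undefined (set_pmf \<circ> (\<lambda>_. pmf_of_set (carrier_vec n)))"
        using xb(2) unfolding random_vecs_def
        by (rule subsetD[OF set_Pi_pmf_subset'[OF finite_atLeastAtMost]])
      then have "x i \<in> set_pmf (pmf_of_set (carrier_vec n))"
        using that by (auto simp: PiE_dflt_def)
      then show ?thesis by (simp add: set_pmf_of_set carrier_vec_mod_ring)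
    qed
    have "x i \<notin> closure_pts n ?M (x ` {1..<i})" if "i \<in> {1..s}" for i
      using xb(1) that by simp
    then obtain c where c: "\<And>i. i \<in> {1..s} \<Longrightarrow> sqf_poly ?M c (x i) \<noteq> 0"
      using ex_nonvanishing[of s x n ?M] xc by blast
    obtain v where v: "card (carrier_vec n :: 'p mod_ring vec set)
        \<le> CARD('p mod_ring) * card {y \<in> carrier_vec n. sqf_poly ?M c y = v}"
      using ex_large_level_set[OF carrier_vec_mod_ring(1)] by blast
    let ?A = "{y \<in> carrier_vec n. sqf_poly ?M c y = v}"
    have "proper_ap_free n k (x ` {1..s}) ?A"
      using c by (intro level_set_proper_ap_free[OF k finM]) auto
    moreover have "1 / real CARD('p) * real CARD('p) ^ n \<le> real (card ?A)"
    proof -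
      have "real (CARD('p) ^ n) \<le> real (CARD('p) * card ?A)"
        using v by (simp only: carrier_vec_mod_ring CARD_mod_ring of_nat_le_iff)
      then show ?thesis by (simp add: divide_le_eq mult.commute)
    qed
    moreover have "?A \<subseteq> carrier_vec n" by auto
    ultimately show "x \<in> ?G" by (intro CollectI exI[of _ ?A] conjI)
  qed
  have "1 - real s * \<beta> \<le> 1 - measure_pmf.prob ?R (\<Union>i\<in>{1..s}. ?E i)" using bad by simp
  also have "\<dots> = measure_pmf.prob ?R (UNIV - (\<Union>i\<in>{1..s}. ?E i))"
    using measure_pmf.prob_compl[of "\<Union>i\<in>{1..s}. ?E i" ?R] by simp
  also have "\<dots> = measure_pmf.prob ?R ((UNIV - (\<Union>i\<in>{1..s}. ?E i)) \<inter> set_pmf ?R)"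
    by (rule measure_Int_set_pmf[symmetric])
  also have "\<dots> \<le> measure_pmf.prob ?R ?G"
    by (rule measure_pmf.finite_measure_mono[OF sub]) simp
  finally show ?thesis .
qed

section \<open>Numerical estimates and the choice of constants\<close>

text \<open>Pascal's rule, \<open>j\<close> times. With \<open>j = d - 1\<close> it bounds the cost
  of keeping only the squarefree ones among the \<open>(n + d - 1) choose d\<close> monomials of
  degree \<open>d\<close>.\<close>

lemma binomial_add_le:
  assumes "0 < d"
  shows "(n + j) choose d \<le> (n choose d) + j * (n + j) ^ (d - 1)"
proof (induction j)
  case (Suc j)
  have le: "m choose r \<le> m ^ r" for m r :: nat
    by (cases "r \<le> m") (auto intro: binomial_le_pow simp: binomial_eq_0)
  have "(n + Suc j) choose d = ((n + j) choose (d - 1)) + ((n + j) choose d)"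
    using assms by (cases d) simp_all
  also have "\<dots> \<le> (n + j) ^ (d - 1) + ((n choose d) + j * (n + j) ^ (d - 1))"
    using Suc le by (intro add_mono) auto
  also have "\<dots> = (n choose d) + Suc j * (n + j) ^ (d - 1)" by simp
  also have "\<dots> \<le> (n choose d) + Suc j * (n + Suc j) ^ (d - 1)"
    by (intro add_left_mono mult_left_mono power_mono) auto
  finally show ?case .
qed simp

text \<open>The exponent before rounding solves \<open>\<rho> powr t = 1 / n ^ r\<close>; rounding
  up only decreases the power.\<close>

lemma power_ceiling_le_inverse_power:
  fixes \<rho> b :: real
  assumes "0 < \<rho>" "\<rho> < 1" "1 < b" "0 < n"
  shows "\<rho> ^ nat \<lceil>real r / (- log b \<rho>) * log b (real n)\<rceil> \<le> 1 / real n ^ r"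
proof -
  let ?a = "real r / (- log b \<rho>)" and ?L = "log b (real n)"
  have neg: "log b \<rho> < 0" using assms by simp
  have "\<rho> ^ nat \<lceil>?a * ?L\<rceil> = \<rho> powr real (nat \<lceil>?a * ?L\<rceil>)"
    using assms by (simp add: powr_realpow)
  also have "\<dots> \<le> \<rho> powr (?a * ?L)"
    using assms by (intro powr_mono') (auto intro: real_nat_ceiling_ge)
  also have "\<dots> = (b powr log b \<rho>) powr (?a * ?L)"
    using assms by simp
  also have "\<dots> = (b powr ?L) powr - real r"
    using neg by (simp add: powr_powr mult.commute)
  also have "\<dots> = 1 / real n ^ r"
    using assms by (simp add: powr_minus powr_realpow divide_inverse)
  finally show ?thesis .
qed

theorem theorem1p2:
  fixes k :: nat
  assumes "3 \<le> k" and "k \<le> CARD('p::prime_card)"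
  shows "\<exists>(C::real) (c::real) (\<epsilon> :: real \<Rightarrow> real) (\<delta> :: nat \<Rightarrow> real).
    0 < C \<and> 0 < c \<and>
    (\<forall>x>0. 0 < \<epsilon> x) \<and> (\<epsilon> \<longlongrightarrow> 0) at_top \<and>
    (\<forall>n. 0 \<le> \<delta> n \<and> \<delta> n \<le> 1) \<and> \<delta> \<longlonglongrightarrow> 0 \<and>
    (\<forall>(n::nat) (s::nat).
      0 < n \<longrightarrow> 0 < s \<longrightarrow>
      real s \<le> real ((n + k - 2) choose (k - 1))
               - C * (log (real CARD('p)) (real n)) powr (1 + \<epsilon> (real n)) * real n ^ (k - 2) \<longrightarrow>
      1 - \<delta> n \<le> measure_pmf.prob (random_vecs n s)
        {x :: nat \<Rightarrow> 'p mod_ring vec.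
          \<exists>A \<subseteq> carrier_vec n.
            c * real CARD('p) ^ n \<le> real (card A) \<and>
            proper_ap_free n k (x ` {1..s}) A})"
proof -
  define d where "d = k - 1"
  define p where "p = real CARD('p)"
  define \<rho> where "\<rho> = 1 - ((p - 1) / p) ^ d"
  \<comment> \<open>With \<open>m\<close> the ceiling of \<open>a * log p n\<close>,
    \<open>\<rho> ^ m\<close> is at most \<open>1 / n ^ (d + 1)\<close>: \<open>d\<close> of these
    factors offset the number of points, the last one makes the failure probability tend to
    0.\<close>
  define a where "a = real (d + 1) / (- log p \<rho>)"
  \<comment> \<open>\<open>K\<close> serves twice: \<open>K * n ^ (d - 1)\<close> covers the loss
    from squarefree monomials, and \<open>K * n ^ d\<close> bounds the number of points.\<close>
  define K where "K = real (d ^ d)"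
  \<comment> \<open>\<open>(a + 1) * d\<close> pays for \<open>m\<close> disjoint leading monomials
    at \<open>d * n ^ (d - 1)\<close> each, \<open>K\<close> for squarefreeness.\<close>
  define C where "C = (a + 1) * real d + K"
  \<comment> \<open>For \<open>0 < n < p + K\<close> the claim is trivial as
    \<open>\<delta> n = 1\<close>; from there on \<open>log p n \<ge> 1\<close>, so additive
    constants can be absorbed into the logarithm.\<close>
  define \<delta> where "\<delta> n = min 1 ((p + K) / real n)" for n
  have d: "2 \<le> d" "k - 1 = d" "k - 2 = d - 1" and p: "3 \<le> p"
    using assms by (auto simp: d_def p_def)
  have "0 < ((p - 1) / p) ^ d" using p by simp
  moreover have "((p - 1) / p) ^ d < 1" using p d by (intro power_less_one_iff[THEN iffD2] conjI) auto
  ultimately have \<rho>: "0 < \<rho>" "\<rho> < 1" unfolding \<rho>_def by linarith+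
  have a: "0 < a" unfolding a_def using \<rho> p by (intro divide_pos_pos) auto
  have K: "0 < K" using d by (simp add: K_def)
  have C: "0 < C" unfolding C_def using a d K by (intro add_nonneg_pos mult_nonneg_nonneg) auto
  have main: "1 - \<delta> n \<le> measure_pmf.prob (random_vecs n s)
        {x :: nat \<Rightarrow> 'p mod_ring vec.
          \<exists>A \<subseteq> carrier_vec n.
            1 / p * real CARD('p) ^ n \<le> real (card A) \<and>
            proper_ap_free n k (x ` {1..s}) A}" (is "_ \<le> ?prob")
    if n: "0 < n" and s: "real s \<le> real ((n + k - 2) choose (k - 1))
               - C * (log (real CARD('p)) (real n)) powr (1 + inverse (real n)) * real n ^ (k - 2)"
    for n s
  proof (cases "real n < p + K")
    case True
    then have "\<delta> n = 1" using n K by (simp add: \<delta>_def le_divide_eq min_def)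
    then show ?thesis by simp
  next
    case False
    define L where "L = log p (real n)"
    define m where "m = nat \<lceil>a * L\<rceil>"
    define N where "N = (n + (d - 1)) choose d"
    have L: "1 \<le> L" using False p K by (simp add: L_def)
    have "n + k - 2 = n + (d - 1)" using assms unfolding d_def by linarith
    then have N: "(n + k - 2) choose (k - 1) = N" by (simp only: N_def d(2))
    have nd: "n + (d - 1) \<le> d * n"
    proof -
      have "d - 1 \<le> (d - 1) * n" using n by simp
      then have "n + (d - 1) \<le> n + (d - 1) * n" by simp
      also have "\<dots> = d * n" using d by (cases d) simp_all
      finally show ?thesis .
    qed
    have "N \<le> (n choose d) + (d - 1) * (n + (d - 1)) ^ (d - 1)"
      unfolding N_def using d by (intro binomial_add_le) simp
    also have "\<dots> \<le> (n choose d) + d * (d * n) ^ (d - 1)"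
      using nd by (intro add_left_mono mult_mono power_mono) auto
    also have "\<dots> = (n choose d) + d ^ d * n ^ (d - 1)"
      using d by (simp add: power_mult_distrib power_eq_if[of d d])
    finally have "real N \<le> real ((n choose d) + d ^ d * n ^ (d - 1))" by (rule of_nat_mono)
    then have N1: "real N \<le> real (n choose d) + K * real n ^ (d - 1)" by (simp add: K_def)
    have "N \<le> (n + (d - 1)) ^ d" unfolding N_def using n by (intro binomial_le_pow) simp
    also have "\<dots> \<le> (d * n) ^ d" using nd by (intro power_mono) auto
    finally have "real N \<le> real ((d * n) ^ d)" by (rule of_nat_mono)
    then have N2: "real N \<le> K * real n ^ d" by (simp add: K_def power_mult_distrib)
    \<comment> \<open>The witness for \<open>\<epsilon>\<close> is the reciprocal, positive with
      limit 0. As \<open>L \<ge> 1\<close>, the exponent \<open>1 + \<epsilon>\<close> can only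
      enlarge \<open>L\<close>, so the assumption on \<open>s\<close> implies the bound with
      \<open>L\<close> itself.\<close>
    have "L = L powr 1" using L by simp
    also have "\<dots> \<le> L powr (1 + inverse (real n))" using L by (intro powr_mono) auto
    finally have "C * L * real n ^ (d - 1) \<le> C * L powr (1 + inverse (real n)) * real n ^ (d - 1)"
      using C by (intro mult_right_mono mult_left_mono) auto
    then have s1: "real s \<le> real N - C * L * real n ^ (d - 1)"
      using s unfolding N d(3) p_def[symmetric] L_def[symmetric] by linarith
    have m: "real m \<le> a * L + 1" unfolding m_def using a L by (simp add: of_nat_nat)
    have "real m * real d + K \<le> (a * L + 1) * real d + K"
      using m by (intro add_right_mono mult_right_mono) auto
    also have "\<dots> \<le> (a * L + L) * real d + K * L"
      using L K by (intro add_mono mult_right_mono) auto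
    also have "\<dots> = C * L" by (simp add: C_def algebra_simps)
    finally have "(real m * real d + K) * real n ^ (d - 1) \<le> C * L * real n ^ (d - 1)"
      by (intro mult_right_mono) auto
    then have "real (s + m * (d * n ^ (d - 1))) \<le> real (n choose d)"
      using s1 N1 by (simp add: algebra_simps)
    then have sm: "s + m * (d * n ^ (d - 1)) \<le> n choose d" by (simp only: of_nat_le_iff)
    have "1 - real s * \<rho> ^ m \<le> ?prob"
      unfolding p_def
    proof (rule prob_ex_ap_free)
      show "2 \<le> k" "k \<le> CARD('p)" "0 \<le> \<rho> ^ m" using assms \<rho> by simp_all
      fix X :: "'p mod_ring vec set" assume "finite X" "card X < s"
      then show "real (card (closure_pts n {T. T \<subseteq> {..<n} \<and> card T = k - 1} X)) \<le> \<rho> ^ m * real CARD('p) ^ n"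
        using card_closure_le[of d n X m] carrier_vec_mod_ring(1)[of n, where 'p='p] d n sm
        by (simp add: \<rho>_def p_def mult.commute)
    qed
    moreover have "real s * \<rho> ^ m \<le> \<delta> n"
    proof -
      have "\<rho> ^ m \<le> 1 / real n ^ (d + 1)"
        unfolding m_def a_def L_def using \<rho> p n by (intro power_ceiling_le_inverse_power) auto
      moreover have "real s \<le> K * real n ^ d"
        using s1 N2 C L by (smt (verit) mult_nonneg_nonneg of_nat_0_le_iff zero_le_power)
      ultimately have "real s * \<rho> ^ m \<le> K * real n ^ d * (1 / real n ^ (d + 1))"
        using \<rho> K by (intro mult_mono) auto
      also have "\<dots> = K / real n" using n by simp
      also have "\<dots> \<le> (p + K) / real n" using p by (intro divide_right_mono) auto
      also have "\<dots> = \<delta> n" using False n by (simp add: \<delta>_def)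
      finally show ?thesis .
    qed
    ultimately show ?thesis by linarith
  qed
  have "\<delta> \<longlonglongrightarrow> min 1 0"
    unfolding \<delta>_def by (intro tendsto_intros lim_const_over_n)
  then have "\<delta> \<longlonglongrightarrow> 0" by simp
  moreover have "\<forall>n. 0 \<le> \<delta> n \<and> \<delta> n \<le> 1" using p K by (simp add: \<delta>_def)
  moreover have "((\<lambda>x::real. inverse x) \<longlongrightarrow> 0) at_top"
    by (rule tendsto_inverse_0_at_top[OF filterlim_ident])
  moreover have "0 < 1 / p" using p by simp
  ultimately show ?thesis using C main
    by (intro exI[of _ C] exI[of _ "1 / p"] exI[of _ "\<lambda>x. inverse x"] exI[of _ \<delta>]) auto
qed

end
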